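(* Let $\gamma$ be a geodesic ray in $L_2$ with $\gamma(0)=id$, and set $f_n=\gamma(n)$. If $[\gamma]\in\partial_\infty L_2^+$, then for all large enough $n$, $f_n$ defines a positive rib function $\mathfrak r^{+,f_n}$ (i.e. $M(f_n)<H(f_n)$), and $\mathfrak r^{+,f_n}\to\mathfrak b^{+,\gamma}$ in $\partial_h L_2$ as $n\to\infty$. If $[\gamma]\in\partial_\infty L_2^-$, then for all large enough $n$, $f_n$ defines a negative rib function $\mathfrak r^{-,f_n}$ (i.e. $m(f_n)\ge H(f_n)$), and $\mathfrak r^{-,f_n}\to\mathfrak b^{-,\gamma}$ in $\partial_h L_2$ as $n\to\infty$.
   Context: Lamplighter group: $L_2=\langle a,t\mid a^2,\ [a^{t^i},a^{t^j}]\ \forall i,j\in\mathbb Z\rangle\cong(\bigoplus_{\mathbb Z}\mathbb Z/2)\rtimes\mathbb Z$. Each element is identified with a lamp stand: a finite set of lit lamps (positions in $\mathbb Z$) together with an integer position of the lamplighter. The identity $id$ has no lit lamps and lamplighter at $0$; right multiplication by $a$ toggles the lamp at the lamplighter's position; right multiplication by $t$ moves the lamplighter by $+1$. $d$ is the word metric on $L_2$ with respect to $S=\{t,at\}$, i.e. $d(g,h)$ is the length of $g^{-1}h$ in $S\cup S^{-1}$. $H(g)$ is the lamplighter's position in $g$; $m(g)$ (resp. $M(g)$) is the minimum (resp. maximum) position of a lit lamp of $g$, with $m(g)=+\infty$, $M(g)=-\infty$ if no lamp is lit. $m(g_1,g_2)$ (resp. $M(g_1,g_2)$) is the minimum (resp.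 maximum) position of a lamp whose status differs in $g_1$ and $g_2$, with value $+\infty$ (resp. $-\infty$) if there is none. Horofunction boundary: $C(L_2)$ is the space of functions $L_2\to\mathbb R$ with the topology of uniform convergence on compact (i.e. finite) sets, so convergence is pointwise convergence; $i(z)(x)=d(z,x)-d(z,id)$ embeds $L_2$ in $C(L_2)$; $\overline{L_2}$ is the closure of $i(L_2)$ and $\partial_h L_2=\overline{L_2}\setminus i(L_2)$. A geodesic ray is an isometric embedding $\gamma:\mathbb N\to L_2$; $[\gamma]$ is its class under the relation $\sup_n d(\gamma(n),\gamma'(n))<\infty$; $\partial_\infty L_2^{\pm}$ is the set of classes of geodesic rays with $\gamma(0)=id$ and $H(\gamma(n))\to\pm\infty$. For such a ray each lamp's status in $\gamma(n)$ is eventually constant; the resulting (possibly infinite) configuration is the infinite lamp stand of $\gamma$; $m(\gamma),m(\gamma,g)$ (for $\partial_\infty L_2^+$) and $M(\gamma),M(\gamma,g)$ (for $\partial_\infty L_2^-$) are defined from it as for group elements. Formulas (all are points of $\partial_h L_2$), for $g\in L_2$: $\mathfrak b^{+,\gamma}(g)=2(\min\{m(\gamma),0\}-\min\{m(\gamma,g),H(g)\})+H(g)$ for $[\gamma]\in\partial_\infty L_2^+$; $\mathfrak b^{-,\gamma}(g)=2(\max\{M(\gamma,g)+1,H(g)\}-\max\{M(\gamma)+1,0\})-H(g)$ for $[\gamma]\in\partial_\infty L_2^-$; (these equal the Busemann functions $\lim_n (d(\gamma(n),g)-d(\gamma(n),id))$); $\mathfrak s^l(g)=|l|-|l-H(g)|$;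 $\mathfrak r^{+,f}(g)=2(\min\{m(f),l,0\}-\min\{m(f,g),H(g),l\})+\mathfrak s^l(g)$ where $l=H(f)$ and $M(f)<l$; $\mathfrak r^{-,f}(g)=2(\max\{M(f,g)+1,H(g),l\}-\max\{M(f)+1,l,0\})+\mathfrak s^l(g)$ where $l=H(f)$ and $m(f)\ge l$. *)

theory Defs
  imports
    "HOL-Analysis.Analysis"
    "HOL-Library.FSet"
    "HOL-Algebra.Generated_Groups"
begin

section \<open>The lamplighter group\<close>

datatype lampstand = Lampstand (lit: "int fset") (position: int)

text \<open>
  The lamp stand \<open>(A, k)\<close> is the element of the semidirect product of the direct sum of
  copies of \<open>Z/2\<close> over \<open>Z\<close> by \<open>Z\<close> whose first component is the indicator of \<open>A\<close>.
\<close>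

definition lamplighter :: "lampstand monoid" where
  "lamplighter =
    \<lparr>carrier = UNIV,
     mult = (\<lambda>g h. let B = (\<lambda>i. position g + i) |`| lit h in
               Lampstand ((lit g |-| B) |\<union>| (B |-| lit g)) (position g + position h)),
     one = Lampstand {||} 0\<rparr>"

definition gen_a :: lampstand where
  "gen_a = Lampstand {|0|} 0"

definition gen_t :: lampstand where
  "gen_t = Lampstand {||} 1"

lemma mult_gen_a:
  "g \<otimes>\<^bsub>lamplighter\<^esub> gen_a =
    Lampstand (if position g |\<in>| lit g then lit g |-| {|position g|} else finsert (position g) (lit g))
      (position g)"
  by (auto simp: lamplighter_def gen_a_def Let_def)

lemma mult_gen_t: "g \<otimes>\<^bsub>lamplighter\<^esub> gen_t = Lampstand (lit g) (position g + 1)"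
  by (auto simp: lamplighter_def gen_t_def Let_def)

lemma group_lamplighter: "group lamplighter"
proof (rule groupI)
  fix x y z assume "x \<in> carrier lamplighter" "y \<in> carrier lamplighter" "z \<in> carrier lamplighter"
  show "x \<otimes>\<^bsub>lamplighter\<^esub> y \<otimes>\<^bsub>lamplighter\<^esub> z = x \<otimes>\<^bsub>lamplighter\<^esub> (y \<otimes>\<^bsub>lamplighter\<^esub> z)"
    by (auto simp: lamplighter_def Let_def image_iff algebra_simps)
next
  fix x assume "x \<in> carrier lamplighter"
  show "\<exists>y\<in>carrier lamplighter. y \<otimes>\<^bsub>lamplighter\<^esub> x = \<one>\<^bsub>lamplighter\<^esub>"
    by (rule bexI[of _ "Lampstand ((\<lambda>i. i - position x) |`| lit x) (- position x)"])
       (auto simp: lamplighter_def Let_def)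
next
  fix x assume "x \<in> carrier lamplighter"
  have "(+) 0 |`| lit x = lit x"
    by (auto simp: image_iff)
  then show "\<one>\<^bsub>lamplighter\<^esub> \<otimes>\<^bsub>lamplighter\<^esub> x = x"
    by (simp add: lamplighter_def Let_def)
qed (auto simp: lamplighter_def Let_def)

definition gens :: "lampstand set" where
  "gens = {gen_t, gen_a \<otimes>\<^bsub>lamplighter\<^esub> gen_t}"


section \<open>Word metric\<close>

definition word_length :: "('a, 'b) monoid_scheme \<Rightarrow> 'a set \<Rightarrow> 'a \<Rightarrow> nat" where
  "word_length G S g =
    (LEAST n. \<exists>w. length w = n \<and> set w \<subseteq> S \<union> m_inv G ` S \<and> foldr (mult G) w \<one>\<^bsub>G\<^esub> = g)"

lemma ex_word_if_generate:
  assumes "group G" "S \<subseteq> carrier G" "g \<in> generate G S"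
  shows "\<exists>w. set w \<subseteq> S \<union> m_inv G ` S \<and> foldr (mult G) w \<one>\<^bsub>G\<^esub> = g"
  using assms(3)
proof (induction rule: generate.induct)
  interpret group G by fact
  case one
  show ?case by (rule exI[of _ "[]"]) simp
next
  interpret group G by fact
  case (incl h)
  with assms(2) show ?case by (intro exI[of _ "[h]"]) auto
next
  interpret group G by fact
  case (inv h)
  with assms(2) show ?case by (intro exI[of _ "[m_inv G h]"]) auto
next
  interpret group G by fact
  case (eng h1 h2)
  then obtain w1 w2
    where w1: "set w1 \<subseteq> S \<union> m_inv G ` S" "foldr (mult G) w1 \<one>\<^bsub>G\<^esub> = h1"
      and w2: "set w2 \<subseteq> S \<union> m_inv G ` S" "foldr (mult G) w2 \<one>\<^bsub>G\<^esub> = h2"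
    by blast
  have sub: "S \<union> m_inv G ` S \<subseteq> carrier G"
    using assms(2) by auto
  have closed: "foldr (mult G) w \<one>\<^bsub>G\<^esub> \<in> carrier G" if "set w \<subseteq> carrier G" for w
    using that by (induction w) auto
  have h2: "h2 \<in> carrier G"
    using closed[of w2] w2 sub by blast
  have "foldr (mult G) (w @ w2) \<one>\<^bsub>G\<^esub> = foldr (mult G) w \<one>\<^bsub>G\<^esub> \<otimes>\<^bsub>G\<^esub> h2"
    if "set w \<subseteq> carrier G" for w
    using that
  proof (induction w)
    case Nil
    then show ?case using w2 h2 by simp
  next
    case (Cons x w)
    then show ?case using h2 closed[of w] by (auto simp: m_assoc)
  qed
  from this[of w1] show ?case
    using w1 w2 sub by (intro exI[of _ "w1 @ w2"]) auto
qed

lemma generate_gens: "generate lamplighter gens = UNIV"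
proof -
  interpret group lamplighter by (rule group_lamplighter)
  have carr: "x \<in> carrier lamplighter" for x by (simp add: lamplighter_def)
  let ?G = "generate lamplighter gens"
  have t: "gen_t \<in> ?G" and at: "gen_a \<otimes>\<^bsub>lamplighter\<^esub> gen_t \<in> ?G"
    by (auto intro: generate.incl simp: gens_def)
  have inv_t: "inv\<^bsub>lamplighter\<^esub> gen_t = Lampstand {||} (-1)"
    by (rule inv_equality) (auto simp: carr, simp add: lamplighter_def gen_t_def)
  have ti: "Lampstand {||} (-1) \<in> ?G"
    using generate.inv[of gen_t gens lamplighter] by (simp add: gens_def inv_t)
  have a: "gen_a \<in> ?G"
    using generate.eng[OF at ti] by (simp add: lamplighter_def gen_a_def gen_t_def)
  have up: "Lampstand A (p + 1) \<in> ?G" if "Lampstand A p \<in> ?G" for A p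
    using generate.eng[OF that t] by (simp add: mult_gen_t)
  have down: "Lampstand A (p - 1) \<in> ?G" if "Lampstand A p \<in> ?G" for A p
    using generate.eng[OF that ti] by (simp add: lamplighter_def)
  have move: "Lampstand A q \<in> ?G" if "Lampstand A p \<in> ?G" for A p q
    by (induction q rule: int_induct[of _ p]) (use that up down in auto)
  have "Lampstand A p \<in> ?G" for A p
  proof (induction A arbitrary: p rule: fset_induct)
    case empty
    show ?case using move[of "{||}" 1] t by (simp add: gen_t_def)
  next
    case (insert i A)
    have "Lampstand A i \<otimes>\<^bsub>lamplighter\<^esub> gen_a \<in> ?G"
      by (intro generate.eng insert.IH a)
    then show ?case
      using insert move by (cases "i |\<in>| A") (auto simp: mult_gen_a finsert_absorb)
  qed
  then show ?thesis
    by (metis UNIV_eq_I lampstand.exhaust)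
qed

corollary ex_word_gens:
  "\<exists>w. set w \<subseteq> gens \<union> m_inv lamplighter ` gens \<and> foldr (mult lamplighter) w \<one>\<^bsub>lamplighter\<^esub> = g"
  by (rule ex_word_if_generate[OF group_lamplighter]) (simp_all add: generate_gens, simp add: lamplighter_def)

definition d :: "lampstand \<Rightarrow> lampstand \<Rightarrow> real" where
  "d g h = real (word_length lamplighter gens (inv\<^bsub>lamplighter\<^esub> g \<otimes>\<^bsub>lamplighter\<^esub> h))"


section \<open>Horofunction boundary\<close>

text \<open>
  The group is discrete, so uniform convergence on compact sets is pointwise convergence: the
  topology is that of the function type.
\<close>

definition horo_embed :: "lampstand \<Rightarrow> lampstand \<Rightarrow> real" where
  "horo_embed z x = d z x - d z \<one>\<^bsub>lamplighter\<^esub>"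

definition horo_boundary :: "(lampstand \<Rightarrow> real) set" where
  "horo_boundary = closure (range horo_embed) - range horo_embed"


section \<open>Geodesic rays\<close>

definition geodesic_ray :: "(nat \<Rightarrow> lampstand) \<Rightarrow> bool" where
  "geodesic_ray \<gamma> \<longleftrightarrow> (\<forall>m n. d (\<gamma> m) (\<gamma> n) = \<bar>real m - real n\<bar>)"

definition ray_class :: "(nat \<Rightarrow> lampstand) \<Rightarrow> (nat \<Rightarrow> lampstand) set" where
  "ray_class \<gamma> = {\<gamma>'. geodesic_ray \<gamma>' \<and> bdd_above (range (\<lambda>n. d (\<gamma> n) (\<gamma>' n)))}"

definition visual_boundary_pos :: "(nat \<Rightarrow> lampstand) set set" where
  "visual_boundary_pos =
    ray_class ` {\<gamma>. geodesic_ray \<gamma> \<and> \<gamma> 0 = \<one>\<^bsub>lamplighter\<^esub> \<and>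
                    filterlim (\<lambda>n. position (\<gamma> n)) at_top sequentially}"

definition visual_boundary_neg :: "(nat \<Rightarrow> lampstand) set set" where
  "visual_boundary_neg =
    ray_class ` {\<gamma>. geodesic_ray \<gamma> \<and> \<gamma> 0 = \<one>\<^bsub>lamplighter\<^esub> \<and>
                    filterlim (\<lambda>n. position (\<gamma> n)) at_bot sequentially}"

definition limit_lit :: "(nat \<Rightarrow> lampstand) \<Rightarrow> int set" where
  "limit_lit \<gamma> = {i. \<forall>\<^sub>F n in sequentially. i |\<in>| lit (\<gamma> n)}"


section \<open>Extremal lamps\<close>

text \<open>Infima and suprema in \<open>ereal\<close> give the values \<open>\<infinity>\<close> and \<open>-\<infinity>\<close> on the empty set.\<close>

definition min_pos :: "int set \<Rightarrow> ereal" where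
  "min_pos A = (INF i\<in>A. ereal (of_int i))"

definition max_pos :: "int set \<Rightarrow> ereal" where
  "max_pos A = (SUP i\<in>A. ereal (of_int i))"

abbreviation lit_set :: "lampstand \<Rightarrow> int set" where
  "lit_set g \<equiv> fset (lit g)"

abbreviation pos_ereal :: "lampstand \<Rightarrow> ereal" where
  "pos_ereal g \<equiv> ereal (of_int (position g))"


section \<open>Busemann functions and rib functions\<close>

text \<open>
  Every minimum and maximum below is finite where the function is used, so that
  \<^const>\<open>real_of_ereal\<close> loses nothing: one of the arguments is always finite, and the limiting
  lamp stand of a ray is bounded below (above) when its position tends to \<open>\<infinity>\<close> (\<open>-\<infinity>\<close>).
\<close>

definition busemann_pos :: "(nat \<Rightarrow> lampstand) \<Rightarrow> lampstand \<Rightarrow> real" where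
  "busemann_pos \<gamma> g =
    2 * (real_of_ereal (min (min_pos (limit_lit \<gamma>)) 0)
         - real_of_ereal (min (min_pos (sym_diff (limit_lit \<gamma>) (lit_set g))) (pos_ereal g)))
    + of_int (position g)"

definition busemann_neg :: "(nat \<Rightarrow> lampstand) \<Rightarrow> lampstand \<Rightarrow> real" where
  "busemann_neg \<gamma> g =
    2 * (real_of_ereal (max (max_pos (sym_diff (limit_lit \<gamma>) (lit_set g)) + 1) (pos_ereal g))
         - real_of_ereal (max (max_pos (limit_lit \<gamma>) + 1) 0))
    - of_int (position g)"

definition spine :: "int \<Rightarrow> lampstand \<Rightarrow> real" where
  "spine l g = of_int (\<bar>l\<bar> - \<bar>l - position g\<bar>)"

definition rib_pos :: "lampstand \<Rightarrow> lampstand \<Rightarrow> real" where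
  "rib_pos f g =
    2 * (real_of_ereal (Min {min_pos (lit_set f), pos_ereal f, 0})
         - real_of_ereal (Min {min_pos (sym_diff (lit_set f) (lit_set g)), pos_ereal g, pos_ereal f}))
    + spine (position f) g"

definition rib_neg :: "lampstand \<Rightarrow> lampstand \<Rightarrow> real" where
  "rib_neg f g =
    2 * (real_of_ereal (Max {max_pos (sym_diff (lit_set f) (lit_set g)) + 1, pos_ereal g, pos_ereal f})
         - real_of_ereal (Max {max_pos (lit_set f) + 1, pos_ereal f, 0}))
    + spine (position f) g"

end

theory Submission
  imports Defs
begin

text \<open>
  The length of a geodesic from \<open>g\<close> to \<open>h\<close> is \<open>2 (r - l) - \<bar>H(g) - H(h)\<bar>\<close>, where \<open>[l, r]\<close> is the
  smallest interval containing both positions and, for every lamp \<open>i\<close> in which \<open>g\<close> and \<open>h\<close> differ,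
  the edge from \<open>i\<close> to \<open>i + 1\<close>. Comparing this with the interval visited by a geodesic ray from the
  identity whose position tends to \<open>\<infinity>\<close> shows that the ray eventually steps to a new rightmost position
  every time. From then on, lamps left of the lamplighter are frozen and none is lit elsewhere, so that
  \<open>r(f\<^sub>n)(g)\<close> is equal to \<open>b(g)\<close> once \<open>H(f\<^sub>n)\<close> exceeds \<open>0\<close> and \<open>H(g)\<close>. A positive rib function of \<open>f\<close> is
  the limit of the functions embedding \<open>f\<close> with one more lamp lit at \<open>k \<rightarrow> \<infinity>\<close>, hence the Busemann function
  too is a limit of embedded points. Neither is itself embedded, by boundedness: an embedded point is
  bounded below and has finite sublevel sets. Downward rays follow by reflecting \<open>\<int>\<close>.
\<close>

section \<open>Group operations and single steps of the lamplighter\<close>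

interpretation lamplighter: group lamplighter
  rewrites "carrier lamplighter = UNIV"
  by (rule group_lamplighter) (simp add: lamplighter_def)

lemma position_one [simp]: "position \<one>\<^bsub>lamplighter\<^esub> = 0"
  and lit_one [simp]: "lit \<one>\<^bsub>lamplighter\<^esub> = {||}"
  by (simp_all add: lamplighter_def)

lemma position_mult: "position (g \<otimes>\<^bsub>lamplighter\<^esub> h) = position g + position h"
  and lit_set_mult:
    "lit_set (g \<otimes>\<^bsub>lamplighter\<^esub> h) = sym_diff (lit_set g) ((+) (position g) ` lit_set h)"
  by (auto simp: lamplighter_def Let_def)

lemma m_inv_lamplighter:
  "inv\<^bsub>lamplighter\<^esub> g = Lampstand ((\<lambda>i. i - position g) |`| lit g) (- position g)"
  by (rule lamplighter.inv_equality) (auto simp: lamplighter_def Let_def)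

text \<open>Reads a word as a path from the identity: its last letter is the last step, a right
  multiplication.\<close>

lemma foldr_mult_snoc:
  "foldr (mult lamplighter) (w @ [s]) \<one>\<^bsub>lamplighter\<^esub> =
    foldr (mult lamplighter) w \<one>\<^bsub>lamplighter\<^esub> \<otimes>\<^bsub>lamplighter\<^esub> s"
  by (induction w) (simp_all add: lamplighter.m_assoc)

text \<open>Both generators and their inverses cross an edge of \<open>\<int>\<close>, and may toggle only the lamp at
  its left end.\<close>

definition adjacent :: "lampstand \<Rightarrow> lampstand \<Rightarrow> bool" where
  "adjacent g h \<longleftrightarrow> \<bar>position h - position g\<bar> = 1 \<and>
    sym_diff (lit_set g) (lit_set h) \<subseteq> {min (position g) (position h)}"

text \<open>The inverse of the second generator moves left before it toggles, so its lamp is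
  \<open>-1\<close>.\<close>

lemma gens_and_inverses:
  "gens \<union> m_inv lamplighter ` gens =
    {Lampstand {||} 1, Lampstand {|0|} 1, Lampstand {||} (-1), Lampstand {|-1|} (-1)}"
proof -
  have "gen_a \<otimes>\<^bsub>lamplighter\<^esub> gen_t = Lampstand {|0|} 1"
    by (simp add: mult_gen_t) (simp add: gen_a_def)
  then show ?thesis
    by (auto simp: gens_def m_inv_lamplighter gen_t_def)
qed

lemma lampstand_eqI: "lit_set g = lit_set h \<Longrightarrow> position g = position h \<Longrightarrow> g = h"
  by (simp add: lampstand.expand fset_inject)

text \<open>A step is determined by its direction and by whether the lamp of the crossed edge is
  toggled; these four choices match the four letters.\<close>

lemma adjacent_iff:
  "adjacent g h \<longleftrightarrow> (\<exists>s \<in> gens \<union> m_inv lamplighter ` gens. h = g \<otimes>\<^bsub>lamplighter\<^esub> s)"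
proof
  assume "\<exists>s \<in> gens \<union> m_inv lamplighter ` gens. h = g \<otimes>\<^bsub>lamplighter\<^esub> s"
  then show "adjacent g h"
    unfolding gens_and_inverses adjacent_def by (auto simp: position_mult lit_set_mult)
next
  assume adj: "adjacent g h"
  define T where "T = sym_diff (lit_set g) (lit_set h)"
  have h: "lit_set h = sym_diff (lit_set g) T"
    by (auto simp: T_def)
  from adj have T: "T \<subseteq> {min (position g) (position h)}"
    by (simp add: adjacent_def T_def)
  from adj have "\<bar>position h - position g\<bar> = 1"
    by (simp add: adjacent_def)
  then consider "position h = position g + 1" | "position h = position g - 1"
    by linarith
  then show "\<exists>s \<in> gens \<union> m_inv lamplighter ` gens. h = g \<otimes>\<^bsub>lamplighter\<^esub> s"
  proof cases
    case 1
    with T have "T = {} \<or> T = {position g}"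
      by auto
    then have "h = g \<otimes>\<^bsub>lamplighter\<^esub> Lampstand {||} 1 \<or> h = g \<otimes>\<^bsub>lamplighter\<^esub> Lampstand {|0|} 1"
      by (elim disj_forward; intro lampstand_eqI) (simp_all add: h 1 position_mult lit_set_mult)
    then show ?thesis
      unfolding gens_and_inverses by blast
  next
    case 2
    with T have "T = {} \<or> T = {position g - 1}"
      by auto
    then have "h = g \<otimes>\<^bsub>lamplighter\<^esub> Lampstand {||} (-1) \<or> h = g \<otimes>\<^bsub>lamplighter\<^esub> Lampstand {|-1|} (-1)"
      by (elim disj_forward; intro lampstand_eqI) (simp_all add: h 2 position_mult lit_set_mult)
    then show ?thesis
      unfolding gens_and_inverses by blast
  qed
qed

lemma ex_word_of_word_length:
  "\<exists>w. length w = word_length lamplighter gens g \<and> set w \<subseteq> gens \<union> m_inv lamplighter ` gens \<and>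
    foldr (mult lamplighter) w \<one>\<^bsub>lamplighter\<^esub> = g"
  unfolding word_length_def by (rule LeastI_ex) (use ex_word_gens in blast)

lemma word_length_le_adjacent:
  assumes "adjacent g h"
  shows "word_length lamplighter gens h \<le> Suc (word_length lamplighter gens g)"
proof -
  obtain s where s: "s \<in> gens \<union> m_inv lamplighter ` gens" "h = g \<otimes>\<^bsub>lamplighter\<^esub> s"
    using assms adjacent_iff by blast
  obtain w where "length w = word_length lamplighter gens g"
    "set w \<subseteq> gens \<union> m_inv lamplighter ` gens" "foldr (mult lamplighter) w \<one>\<^bsub>lamplighter\<^esub> = g"
    using ex_word_of_word_length by blast
  then have "\<exists>w. length w = Suc (word_length lamplighter gens g) \<and>
      set w \<subseteq> gens \<union> m_inv lamplighter ` gens \<and> foldr (mult lamplighter) w \<one>\<^bsub>lamplighter\<^esub> = h"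
    using s by (intro exI[of _ "w @ [s]"]) (simp only: foldr_mult_snoc, simp)
  then show ?thesis
    unfolding word_length_def by (rule Least_le)
qed

section \<open>Word length through enclosing intervals\<close>

definition encloses :: "int \<Rightarrow> int \<Rightarrow> lampstand \<Rightarrow> lampstand \<Rightarrow> bool" where
  "encloses l r g h \<longleftrightarrow> {position g, position h} \<subseteq> {l..r} \<and>
    sym_diff (lit_set g) (lit_set h) \<subseteq> {l..<r}"

text \<open>Along a path from the identity the interval of visited positions is enclosing, and
  \<open>2 (r - l) - \<bar>position\<bar>\<close> grows by at most \<open>1\<close> per step.\<close>

lemma encloses_adjacent:
  assumes "encloses l r \<one>\<^bsub>lamplighter\<^esub> g" "adjacent g h"
  shows "encloses (min l (position h)) (max r (position h)) \<one>\<^bsub>lamplighter\<^esub> h"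
    and "2 * (max r (position h) - min l (position h)) - \<bar>position h\<bar>
      \<le> 2 * (r - l) - \<bar>position g\<bar> + 1"
proof -
  have g: "l \<le> 0" "0 \<le> r" "l \<le> position g" "position g \<le> r" "lit_set g \<subseteq> {l..<r}"
    using assms(1) by (auto simp: encloses_def)
  have h: "\<bar>position h - position g\<bar> = 1"
    "lit_set h \<subseteq> lit_set g \<union> {min (position g) (position h)}"
    using assms(2) by (auto simp: adjacent_def)
  show "encloses (min l (position h)) (max r (position h)) \<one>\<^bsub>lamplighter\<^esub> h"
  proof -
    have "x \<in> {min l (position h)..<max r (position h)}" if "x \<in> lit_set h" for x
    proof -
      from that h(2) consider "x \<in> {l..<r}" | "x = min (position g) (position h)"
        using g(5) by blast
      then show ?thesis
        using g(1-4) h(1) by cases auto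
    qed
    then show ?thesis
      using g by (auto simp: encloses_def)
  qed
  show "2 * (max r (position h) - min l (position h)) - \<bar>position h\<bar>
      \<le> 2 * (r - l) - \<bar>position g\<bar> + 1"
    using g h(1) by (auto simp: max_def min_def abs_if split: if_splits)
qed

text \<open>The lower bound on word length: a shortest word is a path from the identity, and the
  interval it visits is the witness.\<close>

lemma ex_encloses_word_length:
  "\<exists>l r. encloses l r \<one>\<^bsub>lamplighter\<^esub> g \<and>
    2 * (r - l) - \<bar>position g\<bar> \<le> int (word_length lamplighter gens g)"
proof -
  have "\<exists>l r. encloses l r \<one>\<^bsub>lamplighter\<^esub> g \<and> 2 * (r - l) - \<bar>position g\<bar> \<le> int (length w)"
    if "set w \<subseteq> gens \<union> m_inv lamplighter ` gens" "foldr (mult lamplighter) w \<one>\<^bsub>lamplighter\<^esub> = g"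
    for w g
    using that
  proof (induction w arbitrary: g rule: rev_induct)
    case Nil
    then show ?case
      by (intro exI[of _ 0]) (auto simp: encloses_def)
  next
    case (snoc s w)
    let ?h = "foldr (mult lamplighter) w \<one>\<^bsub>lamplighter\<^esub>"
    have "adjacent ?h g"
      using snoc.prems unfolding adjacent_iff foldr_mult_snoc by auto
    moreover obtain l r where "encloses l r \<one>\<^bsub>lamplighter\<^esub> ?h"
      "2 * (r - l) - \<bar>position ?h\<bar> \<le> int (length w)"
      using snoc.IH[of ?h] snoc.prems by auto
    ultimately show ?case
      using encloses_adjacent[of l r ?h g]
      by (intro exI[of _ "min l (position g)"] exI[of _ "max r (position g)"]) simp
  qed
  then show ?thesis
    using ex_word_of_word_length by metis
qed

text \<open>A geodesic sweeps the enclosing interval, visiting first the end that lies across \<open>0\<close> from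
  its final position; the cases take back its last step.\<close>

lemma word_length_le_encloses:
  assumes "encloses l r \<one>\<^bsub>lamplighter\<^esub> g"
  shows "int (word_length lamplighter gens g) \<le> 2 * (r - l) - \<bar>position g\<bar>"
  using assms
\<comment> \<open>The induction is on the bound itself, which drops by exactly one when the last
  step of a sweep is undone.\<close>
proof (induction "nat (2 * (r - l) - \<bar>position g\<bar>)" arbitrary: l r g)
  case 0
  then have "l = 0" "r = 0" "g = \<one>\<^bsub>lamplighter\<^esub>"
    by (auto simp: encloses_def intro!: lampstand_eqI)
  moreover have "word_length lamplighter gens \<one>\<^bsub>lamplighter\<^esub> = 0"
    unfolding word_length_def by (rule Least_eq_0) simp
  ultimately show ?case
    by simp
next
  case (Suc n)
  have box: "l \<le> 0" "0 \<le> r" "l \<le> position g" "position g \<le> r" "lit_set g \<subseteq> {l..<r}"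
    using Suc.prems by (auto simp: encloses_def)
  have step: ?case
    if "encloses l' r' \<one>\<^bsub>lamplighter\<^esub> h" "adjacent h g"
      "2 * (r' - l') - \<bar>position h\<bar> = 2 * (r - l) - \<bar>position g\<bar> - 1" for l' r' h
    using Suc.hyps(1)[of r' l' h] Suc.hyps(2) that word_length_le_adjacent[of h g] by linarith
  consider "0 \<le> position g" "position g < r" | "0 < position g" "position g = r"
    | "position g = 0" "r = 0" "l < 0"
    | "position g < 0" "l < position g" | "position g < 0" "position g = l"
    using box Suc.hyps(2) by force
  then show ?case
  proof cases
    case 1
    show ?thesis
      by (rule step[of l r "Lampstand (lit g) (position g + 1)"])
        (use 1 box in \<open>auto simp: encloses_def adjacent_def\<close>)
  next
    \<comment> \<open>Clearing the lamp at \<open>position g - 1\<close> makes the predecessor fit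
      into the interval ending at \<open>r - 1\<close>; the step back relights it if necessary. Case
      5 does the same at the left end.\<close>
    case 2
    show ?thesis
      by (rule step[of l "r - 1" "Lampstand (lit g |-| {|position g - 1|}) (position g - 1)"])
        (use 2 box in \<open>force simp: encloses_def adjacent_def\<close>)+
  next
    case 3
    show ?thesis
      by (rule step[of l r "Lampstand (lit g) (position g - 1)"])
        (use 3 box in \<open>auto simp: encloses_def adjacent_def\<close>)
  next
    case 4
    show ?thesis
      by (rule step[of l r "Lampstand (lit g) (position g - 1)"])
        (use 4 box in \<open>auto simp: encloses_def adjacent_def\<close>)
  next
    case 5
    show ?thesis
      by (rule step[of "l + 1" r "Lampstand (lit g |-| {|position g|}) (position g + 1)"])
        (use 5 box in \<open>force simp: encloses_def adjacent_def\<close>)+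
  qed
qed

section \<open>The distance formula\<close>

lemma position_inv_mult:
  "position (inv\<^bsub>lamplighter\<^esub> g \<otimes>\<^bsub>lamplighter\<^esub> h) = position h - position g"
  by (simp add: position_mult m_inv_lamplighter)

text \<open>Left multiplication only shifts the picture, so the bounds at the identity carry over to
  arbitrary pairs.\<close>

lemma encloses_translate:
  "encloses l r \<one>\<^bsub>lamplighter\<^esub> (inv\<^bsub>lamplighter\<^esub> g \<otimes>\<^bsub>lamplighter\<^esub> h) \<longleftrightarrow>
    encloses (l + position g) (r + position g) g h"
proof -
  have "lit_set (inv\<^bsub>lamplighter\<^esub> g \<otimes>\<^bsub>lamplighter\<^esub> h) =
      (\<lambda>i. i - position g) ` sym_diff (lit_set g) (lit_set h)"
    by (auto simp: lit_set_mult m_inv_lamplighter image_iff)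
  moreover have "(\<lambda>i. i - p) ` T \<subseteq> {l..<r} \<longleftrightarrow> T \<subseteq> {l + p..<r + p}" for p T
    by (force simp: image_subset_iff)
  ultimately show ?thesis
    unfolding encloses_def by (simp only: lit_one position_one position_inv_mult, auto)
qed

lemma d_le_encloses:
  assumes "encloses l r g h"
  shows "d g h \<le> of_int (2 * (r - l) - \<bar>position h - position g\<bar>)"
  using word_length_le_encloses[of "l - position g" "r - position g"
      "inv\<^bsub>lamplighter\<^esub> g \<otimes>\<^bsub>lamplighter\<^esub> h"] assms
  unfolding encloses_translate d_def position_inv_mult
  by simp

text \<open>The interval supplied by the lower bound also gives the upper bound, so equality
  holds.\<close>

lemma ex_encloses_d:
  "\<exists>l r. encloses l r g h \<and> d g h = of_int (2 * (r - l) - \<bar>position h - position g\<bar>)"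
proof -
  obtain l r where lr: "encloses l r \<one>\<^bsub>lamplighter\<^esub> (inv\<^bsub>lamplighter\<^esub> g \<otimes>\<^bsub>lamplighter\<^esub> h)"
    "2 * (r - l) - \<bar>position h - position g\<bar>
      \<le> int (word_length lamplighter gens (inv\<^bsub>lamplighter\<^esub> g \<otimes>\<^bsub>lamplighter\<^esub> h))"
    using ex_encloses_word_length[of "inv\<^bsub>lamplighter\<^esub> g \<otimes>\<^bsub>lamplighter\<^esub> h"]
    unfolding position_inv_mult by blast
  have enc: "encloses (l + position g) (r + position g) g h"
    using lr(1) by (simp add: encloses_translate)
  have "of_int (2 * (r - l) - \<bar>position h - position g\<bar>) \<le> d g h"
    using lr(2) unfolding d_def by linarith
  then show ?thesis
    using enc d_le_encloses[OF enc]
    by (intro exI[of _ "l + position g"] exI[of _ "r + position g"]) simp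
qed

text \<open>Both ends are forced: every enclosing interval contains \<open>l\<close> and
  \<open>r\<close>, since a differing lamp \<open>i\<close> requires both \<open>i\<close> and
  \<open>i + 1\<close>. Hence none is shorter.\<close>

lemma d_eqI:
  assumes "encloses l r g h"
    and "l \<in> {position g, position h} \<union> sym_diff (lit_set g) (lit_set h)"
    and "r \<in> {position g, position h} \<union> (\<lambda>i. i + 1) ` sym_diff (lit_set g) (lit_set h)"
  shows "d g h = of_int (2 * (r - l) - \<bar>position h - position g\<bar>)"
proof -
  obtain l' r' where lr: "encloses l' r' g h" "d g h = of_int (2 * (r' - l') - \<bar>position h - position g\<bar>)"
    using ex_encloses_d by blast
  have sub: "{position g, position h} \<subseteq> {l'..r'}"
    "sym_diff (lit_set g) (lit_set h) \<subseteq> {l'..<r'}"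
    using lr(1) by (simp_all only: encloses_def)
  have "T \<subseteq> {l'..r'} \<and> (\<lambda>i. i + 1) ` T \<subseteq> {l'..r'}" if "T \<subseteq> {l'..<r'}" for T
    using that by force
  note this[OF sub(2)]
  then have "l \<in> {l'..r'}" "r \<in> {l'..r'}"
    using assms(2,3) sub(1) by blast+
  then have "l' \<le> l" "r \<le> r'"
    by simp_all
  then show ?thesis
    using d_le_encloses[OF assms(1)] lr(2) by simp
qed

lemma encloses_commute: "encloses l r g h \<longleftrightarrow> encloses l r h g"
  by (auto simp: encloses_def)

text \<open>\<open>d\<close> depends only on the displacement and on the least width of an enclosing
  interval. This serves for symmetry and for reflection.\<close>

lemma d_eq_if_encloses_iff:
  assumes "\<And>l r. encloses l r g h \<Longrightarrow> \<exists>l' r'. encloses l' r' g' h' \<and> r' - l' = r - l"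
    and "\<And>l r. encloses l r g' h' \<Longrightarrow> \<exists>l' r'. encloses l' r' g h \<and> r' - l' = r - l"
    and "\<bar>position h' - position g'\<bar> = \<bar>position h - position g\<bar>"
  shows "d g h = d g' h'"
proof (rule antisym)
  show "d g h \<le> d g' h'"
    using ex_encloses_d[of g' h'] assms d_le_encloses[of _ _ g h] by metis
  show "d g' h' \<le> d g h"
    using ex_encloses_d[of g h] assms d_le_encloses[of _ _ g' h'] by metis
qed

lemma d_commute: "d g h = d h g"
  by (rule d_eq_if_encloses_iff) (auto simp: encloses_commute)

lemma abs_position_diff_le_d: "of_int \<bar>position h - position g\<bar> \<le> d g h"
proof -
  obtain l r where "encloses l r g h" "d g h = of_int (2 * (r - l) - \<bar>position h - position g\<bar>)"
    using ex_encloses_d by blast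
  then show ?thesis
    by (auto simp: encloses_def abs_if)
qed

text \<open>For width w and displacement s, 2 w - s = 1 and 0 \<le> s \<le> w force w = s = 1,
  leaving a single edge whose lamp may differ.\<close>

lemma adjacent_if_d_eq_1:
  assumes "d g h = 1"
  shows "adjacent g h"
proof -
  obtain l r where lr: "encloses l r g h" "d g h = of_int (2 * (r - l) - \<bar>position h - position g\<bar>)"
    using ex_encloses_d by blast
  have *: "l \<le> position g" "position g \<le> r" "l \<le> position h" "position h \<le> r"
    "2 * (r - l) - \<bar>position h - position g\<bar> = 1"
    using lr assms by (simp_all add: encloses_def)
  then have "r - l < 2"
    by arith
  moreover have "0 < r - l"
    using * by arith
  ultimately have "r = l + 1"
    by arith
  moreover from this have "\<bar>position h - position g\<bar> = 1"
    using * by arith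
  moreover from calculation have "l = min (position g) (position h)"
    using * by arith
  moreover have "{l..<r} = {l}"
    using \<open>r = l + 1\<close> by auto
  ultimately show ?thesis
    using lr(1) by (simp add: encloses_def adjacent_def)
qed

section \<open>Reflection of the integers\<close>

text \<open>The reflection of \<open>\<int>\<close> that fixes the origin for the lamplighter must send the edge right of
  \<open>i\<close>, and hence the lamp \<open>i\<close>, to \<open>- 1 - i\<close>.\<close>

definition mirror :: "lampstand \<Rightarrow> lampstand" where
  "mirror g = Lampstand ((\<lambda>i. - 1 - i) |`| lit g) (- position g)"

lemma position_mirror [simp]: "position (mirror g) = - position g"
  and lit_set_mirror [simp]: "lit_set (mirror g) = (\<lambda>i. - 1 - i) ` lit_set g"
  by (simp_all add: mirror_def)

lemma mirror_mirror [simp]: "mirror (mirror g) = g"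
  by (rule lampstand_eqI) (simp_all add: image_image)

lemma mirror_one [simp]: "mirror \<one>\<^bsub>lamplighter\<^esub> = \<one>\<^bsub>lamplighter\<^esub>"
  by (rule lampstand_eqI) simp_all

lemma sym_diff_mirror:
  "sym_diff ((\<lambda>i. - 1 - i) ` A) ((\<lambda>i. - 1 - i) ` B) = (\<lambda>i::int. - 1 - i) ` sym_diff A B"
  by (auto simp: image_iff)

lemma encloses_mirror: "encloses (- r) (- l) (mirror g) (mirror h) \<longleftrightarrow> encloses l r g h"
proof -
  have "(\<lambda>i. - 1 - i) ` T \<subseteq> {- r..<- l} \<longleftrightarrow> T \<subseteq> {l..<r}" for T
    by (force simp: image_subset_iff)
  then show ?thesis
    by (auto simp only: encloses_def sym_diff_mirror position_mirror lit_set_mirror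
        insert_subset empty_subsetI atLeastAtMost_iff neg_le_iff_le)
qed

lemma d_mirror [simp]: "d (mirror g) (mirror h) = d g h"
proof (rule d_eq_if_encloses_iff)
  fix l r
  show "\<exists>l' r'. encloses l' r' g h \<and> r' - l' = r - l" if "encloses l r (mirror g) (mirror h)"
    using that encloses_mirror[of "- l" "- r" g h] by (intro exI[of _ "- r"] exI[of _ "- l"]) simp
  show "\<exists>l' r'. encloses l' r' (mirror g) (mirror h) \<and> r' - l' = r - l" if "encloses l r g h"
    using that by (intro exI[of _ "- r"] exI[of _ "- l"]) (simp add: encloses_mirror)
qed simp

section \<open>Rib functions as points of the boundary\<close>

lemma min_min_pos_cong:
  assumes "\<And>i. i < c \<Longrightarrow> i \<in> A \<longleftrightarrow> i \<in> B"
  shows "min (min_pos A) (ereal (of_int c)) = min (min_pos B) (ereal (of_int c))"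
proof -
  have "min (min_pos A) (ereal (of_int c)) \<le> min_pos B"
    if "\<And>i. i < c \<Longrightarrow> i \<in> B \<Longrightarrow> i \<in> A" for A B
    unfolding min_pos_def
  proof (rule INF_greatest)
    fix i assume "i \<in> B"
    show "min (INF i\<in>A. ereal (of_int i)) (ereal (of_int c)) \<le> ereal (of_int i)"
    \<comment> \<open>Elements at or beyond \<open>c\<close> are already bounded below by the
      cap.\<close>
    proof (cases "i < c")
      case True
      with that \<open>i \<in> B\<close> have "(INF i\<in>A. ereal (of_int i)) \<le> ereal (of_int i)"
        by (intro INF_lower) blast
      then show ?thesis
        by (rule min.coboundedI1)
    next
      case False
      then show ?thesis
        by (intro min.coboundedI2) simp
    qed
  qed
  from this[of A B] this[of B A] show ?thesis
    using assms by (intro antisym min.boundedI) auto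
qed

lemma min_min_pos_finite:
  assumes "finite A"
  shows "min (min_pos A) (ereal (of_int c)) = ereal (of_int (Min (insert c A)))"
  using assms
proof (induction A)
  case empty
  then show ?case
    by (simp add: min_pos_def top_ereal_def)
next
  case (insert a A)
  have "min (min_pos (insert a A)) (ereal (of_int c)) =
      min (ereal (of_int a)) (min (min_pos A) (ereal (of_int c)))"
    by (simp add: min_pos_def inf_min min.assoc)
  then show ?case
    using insert by (simp add: min_def insert_commute)
qed

text \<open>The left end of the smallest interval enclosing \<open>f\<close> and
  \<open>g\<close>.\<close>

definition leftmost :: "lampstand \<Rightarrow> lampstand \<Rightarrow> int" where
  "leftmost f g = Min ({position f, position g} \<union> sym_diff (lit_set f) (lit_set g))"

text \<open>Both minima are left ends of smallest enclosing intervals, which makes the rib function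
  comparable with the distance formula.\<close>

lemma rib_pos_eq:
  "rib_pos f g =
    of_int (2 * (leftmost f \<one>\<^bsub>lamplighter\<^esub> - leftmost f g) +
      \<bar>position f\<bar> - \<bar>position f - position g\<bar>)"
proof -
  have eq: "real_of_ereal (Min {min_pos A, ereal (of_int p), ereal (of_int q)}) =
      of_int (Min (insert p (insert q A)))" if "finite A" for A p q
  proof -
    have "Min {min_pos A, ereal (of_int p), ereal (of_int q)} =
        min (min_pos A) (ereal (of_int (min p q)))"
      by (simp add: min_def)
    also have "\<dots> = ereal (of_int (Min (insert (min p q) A)))"
      using that by (rule min_min_pos_finite)
    also have "Min (insert (min p q) A) = Min (insert p (insert q A))"
      using that by (cases "A = {}") (simp_all add: min.assoc)
    finally show ?thesis
      by simp
  qed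
  have "real_of_ereal (Min {min_pos (lit_set f), pos_ereal f, 0}) =
      of_int (leftmost f \<one>\<^bsub>lamplighter\<^esub>)"
    using eq[of "lit_set f" "position f" 0] by (simp add: leftmost_def zero_ereal_def)
  moreover have "real_of_ereal (Min {min_pos (sym_diff (lit_set f) (lit_set g)), pos_ereal g, pos_ereal f}) =
      of_int (leftmost f g)"
    by (subst eq) (simp_all add: leftmost_def insert_commute)
  ultimately show ?thesis
    by (simp add: rib_pos_def spine_def)
qed

text \<open>Lighting a lamp far to the right forces every geodesic to the new lamp stand to sweep to the
  right; the rib function of \<open>f\<close> is what remains as that lamp tends to \<open>\<infinity>\<close>.\<close>

definition light :: "int \<Rightarrow> lampstand \<Rightarrow> lampstand" where
  "light k f = Lampstand (finsert k (lit f)) (position f)"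

text \<open>Once \<open>k\<close> exceeds all positions and lamps, the new lamp alone fixes the
  right end \<open>k + 1\<close>, while the left end stays \<open>leftmost f g\<close>.\<close>

lemma d_light:
  "\<forall>\<^sub>F k in at_top. d (light k f) g =
    of_int (2 * (k + 1 - leftmost f g) - \<bar>position f - position g\<bar>)"
proof -
  let ?S = "{position f, position g} \<union> (lit_set f \<union> lit_set g)"
  have "\<forall>\<^sub>F k in at_top. \<forall>i\<in>?S. i < k"
    by (rule eventually_ball_finite) (simp_all add: eventually_gt_at_top del: Un_insert_left)
  then show ?thesis
  proof eventually_elim
    case (elim k)
    have D: "sym_diff (lit_set (light k f)) (lit_set g) =
        insert k (sym_diff (lit_set f) (lit_set g))"
      using elim by (auto simp: light_def)
    define S where "S = {position f, position g} \<union> sym_diff (lit_set f) (lit_set g)"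
    have S: "finite S" "S \<noteq> {}" "leftmost f g = Min S"
      by (auto simp: S_def leftmost_def)
    have "i \<in> {leftmost f g..<k}" if "i \<in> S" for i
    proof -
      have "i < k"
        using elim that by (auto simp: S_def)
      then show ?thesis
        using S that by (metis Min_le atLeastLessThan_iff)
    qed
    then have bounds: "S \<subseteq> {leftmost f g..<k}"
      by blast
    have pos: "position (light k f) = position f"
      by (simp add: light_def)
    have "leftmost f g \<in> S"
      using S by (metis Min_in)
    with bounds have "encloses (leftmost f g) (k + 1) (light k f) g"
      unfolding encloses_def D pos S_def by auto
    moreover have "leftmost f g \<in> {position (light k f), position g} \<union>
        sym_diff (lit_set (light k f)) (lit_set g)"
      using \<open>leftmost f g \<in> S\<close> unfolding D pos S_def by blast
    moreover have "k + 1 \<in> {position (light k f), position g} \<union>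
        (\<lambda>i. i + 1) ` sym_diff (lit_set (light k f)) (lit_set g)"
      unfolding D by blast
    ultimately have "d (light k f) g =
        of_int (2 * (k + 1 - leftmost f g) - \<bar>position g - position (light k f)\<bar>)"
      by (rule d_eqI)
    then show ?case
      by (simp add: light_def abs_minus_commute)
  qed
qed

lemma tendsto_fun_iff:
  fixes f :: "'a \<Rightarrow> 'b \<Rightarrow> 'c::topological_space"
  shows "(f \<longlongrightarrow> b) F \<longleftrightarrow> (\<forall>x. ((\<lambda>n. f n x) \<longlongrightarrow> b x) F)"
  using limitin_componentwise[of "\<lambda>_::'b. euclidean :: 'c topology" UNIV f b F]
  by (simp add: euclidean_product_topology)

text \<open>At the points \<open>light k f\<close> the rib function is eventually constant, whereas
  \<open>horo_embed z\<close> grows like \<open>2 * k\<close>.\<close>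

lemma rib_pos_not_in_range: "rib_pos f \<notin> range horo_embed"
proof
  assume "rib_pos f \<in> range horo_embed"
  then obtain z where z: "rib_pos f = horo_embed z"
    by blast
  let ?R = "\<lambda>k. 2 * (k + 1 - leftmost f z) - \<bar>position f - position z\<bar>"
  let ?C = "2 * (leftmost f \<one>\<^bsub>lamplighter\<^esub> - position f) + \<bar>position f\<bar>"
  have "\<forall>\<^sub>F k in at_top. \<forall>i\<in>insert (position f) (lit_set f). i < k"
    by (rule eventually_ball_finite) (simp_all add: eventually_gt_at_top)
  \<comment> \<open>As \<open>?R k\<close> is \<open>2 * k + ?R 0\<close>, this threshold excludes
    the inequality between \<open>?R k - ?C\<close> and the distance derived below.\<close>
  moreover have "\<forall>\<^sub>F k in at_top. \<bar>\<lceil>d z \<one>\<^bsub>lamplighter\<^esub>\<rceil>\<bar> + \<bar>?C\<bar> + \<bar>?R 0\<bar> < k"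
    by (rule eventually_gt_at_top)
  ultimately have "\<forall>\<^sub>F k::int in at_top. False"
    using d_light[of f z]
  proof eventually_elim
    case (elim k)
    have "sym_diff (lit_set f) (lit_set (light k f)) = {k}"
      using elim(1) by (auto simp: light_def)
    then have "leftmost f (light k f) = position f"
      using elim(1) by (simp add: leftmost_def light_def)
    then have "rib_pos f (light k f) = of_int ?C"
      by (simp add: rib_pos_eq light_def)
    moreover have "horo_embed z (light k f) = of_int (?R k) - d z \<one>\<^bsub>lamplighter\<^esub>"
      using elim(3) by (simp add: horo_embed_def d_commute)
    ultimately have "real_of_int (?R k - ?C) = d z \<one>\<^bsub>lamplighter\<^esub>"
      using z by simp
    then have "?R k - ?C \<le> \<lceil>d z \<one>\<^bsub>lamplighter\<^esub>\<rceil>"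
      by linarith
    moreover have "False" if "\<bar>a\<bar> + \<bar>c\<bar> + \<bar>b\<bar> < k" "2 * k + b - c \<le> a" for a b c :: int
      using that by linarith
    ultimately show False
      using elim(2) by (simp add: algebra_simps)
  qed
  then show False
    by simp
qed

text \<open>In \<open>horo_embed (light k f) x\<close> the two occurrences of \<open>k + 1\<close>
  cancel, leaving \<open>rib_pos f x\<close> for all large \<open>k\<close>.\<close>

lemma rib_pos_in_horo_boundary: "rib_pos f \<in> horo_boundary"
proof -
  have "((\<lambda>k. horo_embed (light k f)) \<longlongrightarrow> rib_pos f) at_top"
    unfolding tendsto_fun_iff
  proof
    fix x
    have "\<forall>\<^sub>F k in at_top. horo_embed (light k f) x = rib_pos f x"
      using d_light[of f x] d_light[of f "\<one>\<^bsub>lamplighter\<^esub>"]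
      by eventually_elim (simp add: horo_embed_def rib_pos_eq)
    then show "((\<lambda>k. horo_embed (light k f) x) \<longlongrightarrow> rib_pos f x) at_top"
      by (rule tendsto_eventually)
  qed
  then have "rib_pos f \<in> closure (range horo_embed)"
    by (rule Lim_in_closed_set[rotated 3])
      (auto intro: eventuallyI closure_subset[THEN subsetD])
  then show ?thesis
    using rib_pos_not_in_range by (simp add: horo_boundary_def)
qed

section \<open>Rays whose position tends to \<infinity>\<close>

locale upward_ray =
  fixes \<gamma> :: "nat \<Rightarrow> lampstand"
  assumes geodesic: "geodesic_ray \<gamma>"
    and start: "\<gamma> 0 = \<one>\<^bsub>lamplighter\<^esub>"
    and upward: "filterlim (\<lambda>n. position (\<gamma> n)) at_top sequentially"
begin

lemma adjacent_ray: "adjacent (\<gamma> n) (\<gamma> (Suc n))"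
  using geodesic by (intro adjacent_if_d_eq_1) (simp add: geodesic_ray_def)

definition lowest :: "nat \<Rightarrow> int" where
  "lowest n = Min ((\<lambda>i. position (\<gamma> i)) ` {..n})"

definition highest :: "nat \<Rightarrow> int" where
  "highest n = Max ((\<lambda>i. position (\<gamma> i)) ` {..n})"

lemma lowest_Suc: "lowest (Suc n) = min (lowest n) (position (\<gamma> (Suc n)))"
  and highest_Suc: "highest (Suc n) = max (highest n) (position (\<gamma> (Suc n)))"
  by (simp_all add: lowest_def highest_def atMost_Suc min.commute max.commute)

lemma position_bounds: "position (\<gamma> n) \<in> {lowest n..highest n}"
  by (simp add: lowest_def highest_def)

lemma zero_bounds: "0 \<in> {lowest n..highest n}"
proof -
  have "position (\<gamma> 0) \<in> {lowest n..highest n}"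
    unfolding lowest_def highest_def by (simp del: start)
  then show ?thesis
    by (simp add: start)
qed

text \<open>Growth by at most one per step gives \<le>; as the distance to the identity is
  \<open>n\<close> and at most the left side, equality follows: the visited interval is
  optimal.\<close>

lemma encloses_and_sweep:
  shows encloses_ray: "encloses (lowest n) (highest n) \<one>\<^bsub>lamplighter\<^esub> (\<gamma> n)"
    and sweep: "2 * (highest n - lowest n) - \<bar>position (\<gamma> n)\<bar> = int n"
proof -
  have "encloses (lowest n) (highest n) \<one>\<^bsub>lamplighter\<^esub> (\<gamma> n) \<and>
    2 * (highest n - lowest n) - \<bar>position (\<gamma> n)\<bar> \<le> int n"
  proof (induction n)
    case 0
    then show ?case
      by (simp add: lowest_def highest_def start encloses_def)
  next
    case (Suc n)
    then show ?case
      using encloses_adjacent[of "lowest n" "highest n" "\<gamma> n" "\<gamma> (Suc n)"] adjacent_ray[of n]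
      by (simp add: lowest_Suc highest_Suc)
  qed
  moreover have "d \<one>\<^bsub>lamplighter\<^esub> (\<gamma> n) = real n"
    using geodesic start[symmetric] by (simp add: geodesic_ray_def)
  ultimately show "encloses (lowest n) (highest n) \<one>\<^bsub>lamplighter\<^esub> (\<gamma> n)"
    "2 * (highest n - lowest n) - \<bar>position (\<gamma> n)\<bar> = int n"
    using d_le_encloses[of "lowest n" "highest n" "\<one>\<^bsub>lamplighter\<^esub>" "\<gamma> n"]
    by (simp, simp, linarith)
qed

text \<open>By the previous lemma every step is efficient, so a ray that has turned back from a positive
  maximum cannot return to it.\<close>

lemma position_eq_highest:
  assumes "1 \<le> highest n"
  shows "position (\<gamma> n) = highest n"
proof (rule ccontr)
  assume neq: "position (\<gamma> n) \<noteq> highest n"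
  have stuck: "highest m = highest n \<and> position (\<gamma> m) < highest n" if "n \<le> m" for m
    using that
  proof (induction m rule: dec_induct)
    case base
    then show ?case
      using neq position_bounds[of n] by simp
  next
    case (step m)
    let ?p = "position (\<gamma> m)" and ?q = "position (\<gamma> (Suc m))"
    have qp: "\<bar>?q - ?p\<bar> = 1"
      using adjacent_ray[of m] by (simp add: adjacent_def)
    then have "?q \<le> highest n"
      using step.IH by linarith
    then have top: "highest (Suc m) = highest n"
      using step.IH by (simp add: highest_Suc)
    have "?q \<noteq> highest n"
    proof
      assume q: "?q = highest n"
      then have p: "?p = ?q - 1"
        using qp step.IH by linarith
      then have "lowest (Suc m) = lowest m"
        using position_bounds[of m] by (simp add: lowest_Suc)
      \<comment> \<open>Going from \<open>highest n - 1 \<ge> 0\<close> up to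
        \<open>highest n\<close> leaves both extremes fixed, so the quantity in \<open>sweep\<close>
        falls by one where it must rise by one.\<close>
      then show False
        using sweep[of m] sweep[of "Suc m"] top q p step.IH assms by simp
    qed
    then show ?case
      using \<open>?q \<le> highest n\<close> top by simp
  qed
  have "\<forall>\<^sub>F m in sequentially. highest n \<le> position (\<gamma> m)"
    using upward by (simp add: filterlim_at_top)
  then obtain m where "n \<le> m" "highest n \<le> position (\<gamma> m)"
    unfolding eventually_sequentially by (metis nle_le)
  then show False
    using stuck[of m] by simp
qed

lemma eventually_position_eq_highest:
  "\<forall>\<^sub>F n in sequentially. position (\<gamma> n) = highest n"
proof -
  have "\<forall>\<^sub>F n in sequentially. 1 \<le> position (\<gamma> n)"
    using upward by (simp add: filterlim_at_top)
  then show ?thesis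
  proof eventually_elim
    case (elim n)
    then have "1 \<le> highest n"
      using position_bounds[of n] by simp
    then show ?case
      by (rule position_eq_highest)
  qed
qed

text \<open>At its maximum the lamplighter stands at the right end of the enclosing interval, and
  lamps lie strictly left of that end.\<close>

lemma eventually_lit_less_position:
  "\<forall>\<^sub>F n in sequentially. \<forall>i\<in>lit_set (\<gamma> n). i < position (\<gamma> n)"
  using eventually_position_eq_highest
proof eventually_elim
  case (elim n)
  then show ?case
    using encloses_ray[of n] by (auto simp: encloses_def)
qed

text \<open>Eventually the position never decreases, and a step can toggle only the lamp at its
  lower end, the current position. All lamps further left are final, uniformly in
  \<open>i\<close>.\<close>

lemma eventually_lit_limit_iff:
  "\<forall>\<^sub>F n in sequentially. \<forall>i<position (\<gamma> n). i \<in> limit_lit \<gamma> \<longleftrightarrow> i \<in> lit_set (\<gamma> n)"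
proof -
  obtain N where N: "\<And>n. N \<le> n \<Longrightarrow> position (\<gamma> n) = highest n"
    using eventually_position_eq_highest unfolding eventually_sequentially by blast
  have "i \<in> limit_lit \<gamma> \<longleftrightarrow> i \<in> lit_set (\<gamma> n)" if n: "N \<le> n" and i: "i < position (\<gamma> n)" for n i
  proof -
    have "i < position (\<gamma> m) \<and> (i \<in> lit_set (\<gamma> m) \<longleftrightarrow> i \<in> lit_set (\<gamma> n))" if "n \<le> m" for m
      using that
    proof (induction m rule: dec_induct)
      case base
      then show ?case
        using i by simp
    next
      case (step m)
      have "position (\<gamma> m) \<le> position (\<gamma> (Suc m))"
        using N[of m] N[of "Suc m"] n step.hyps by (simp add: highest_Suc)
      then show ?case
        using step.IH adjacent_ray[of m] by (auto simp: adjacent_def)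
    qed
    then have "\<forall>\<^sub>F m in sequentially. i \<in> lit_set (\<gamma> m) \<longleftrightarrow> i \<in> lit_set (\<gamma> n)"
      unfolding eventually_sequentially by blast
    then have "(\<forall>\<^sub>F m in sequentially. i \<in> lit_set (\<gamma> m)) \<longleftrightarrow>
        (\<forall>\<^sub>F m in sequentially. i \<in> lit_set (\<gamma> n))"
      by (rule eventually_subst)
    then show ?thesis
      by (simp add: limit_lit_def)
  qed
  then show ?thesis
    unfolding eventually_sequentially by blast
qed

text \<open>The caps \<open>0\<close> and \<open>position g\<close> are eventually at most the
  position of the ray, so only frozen lamps enter the minima.\<close>

lemma tendsto_rib_pos: "((\<lambda>n. rib_pos (\<gamma> n)) \<longlongrightarrow> busemann_pos \<gamma>) sequentially"
  unfolding tendsto_fun_iff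
proof
  fix g
  have "\<forall>\<^sub>F n in sequentially. max 0 (position g) \<le> position (\<gamma> n)"
    using upward by (simp only: filterlim_at_top)
  with eventually_lit_limit_iff have "\<forall>\<^sub>F n in sequentially. rib_pos (\<gamma> n) g = busemann_pos \<gamma> g"
  proof eventually_elim
    case (elim n)
    have "Min {min_pos (lit_set (\<gamma> n)), pos_ereal (\<gamma> n), 0} = min (min_pos (lit_set (\<gamma> n))) 0"
      using elim by (simp add: min_absorb2)
    also have "\<dots> = min (min_pos (limit_lit \<gamma>)) 0"
      using elim min_min_pos_cong[of 0 "lit_set (\<gamma> n)" "limit_lit \<gamma>"] by (simp add: zero_ereal_def)
    finally have 1: "Min {min_pos (lit_set (\<gamma> n)), pos_ereal (\<gamma> n), 0} = \<dots>" .
    have "Min {min_pos (sym_diff (lit_set (\<gamma> n)) (lit_set g)), pos_ereal g, pos_ereal (\<gamma> n)} =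
        min (min_pos (sym_diff (lit_set (\<gamma> n)) (lit_set g))) (pos_ereal g)"
      using elim by (simp add: min_absorb1)
    also have "\<dots> = min (min_pos (sym_diff (limit_lit \<gamma>) (lit_set g))) (pos_ereal g)"
      using elim by (intro min_min_pos_cong) auto
    finally have 2: "Min {min_pos (sym_diff (lit_set (\<gamma> n)) (lit_set g)), pos_ereal g,
        pos_ereal (\<gamma> n)} = \<dots>" .
    have "spine (position (\<gamma> n)) g = of_int (position g)"
      using elim by (simp add: spine_def)
    then show ?case
      by (simp only: rib_pos_def busemann_pos_def 1 2)
  qed
  then show "((\<lambda>n. rib_pos (\<gamma> n) g) \<longlongrightarrow> busemann_pos \<gamma> g) sequentially"
    by (rule tendsto_eventually)
qed

text \<open>The Busemann function tends to \<open>-\<infinity>\<close> along its ray, while \<open>horo_embed z \<ge> - d z 1\<close>.\<close>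

lemma busemann_pos_not_in_range: "busemann_pos \<gamma> \<notin> range horo_embed"
proof
  assume "busemann_pos \<gamma> \<in> range horo_embed"
  then obtain z where z: "busemann_pos \<gamma> = horo_embed z"
    by blast
  let ?c = "2 * real_of_ereal (min (min_pos (limit_lit \<gamma>)) 0) + d z \<one>\<^bsub>lamplighter\<^esub>"
  have "\<forall>\<^sub>F n in sequentially. \<lceil>?c\<rceil> + 1 \<le> position (\<gamma> n)"
    using upward by (simp only: filterlim_at_top)
  with eventually_lit_limit_iff have "\<forall>\<^sub>F n::nat in sequentially. False"
  proof eventually_elim
    case (elim n)
    \<comment> \<open>The ray agrees with its limit left of the lamplighter, so this minimum is the
      position itself; it enters with factor -2 against +1 from the last summand.\<close>
    have "min (min_pos (sym_diff (limit_lit \<gamma>) (lit_set (\<gamma> n)))) (pos_ereal (\<gamma> n)) =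
        min (min_pos {}) (pos_ereal (\<gamma> n))"
      using elim by (intro min_min_pos_cong) auto
    then have "busemann_pos \<gamma> (\<gamma> n) = ?c - d z \<one>\<^bsub>lamplighter\<^esub> - of_int (position (\<gamma> n))"
      by (simp add: busemann_pos_def min_min_pos_finite)
    moreover have "- d z \<one>\<^bsub>lamplighter\<^esub> \<le> horo_embed z (\<gamma> n)"
      by (simp add: horo_embed_def d_def)
    ultimately have "of_int (position (\<gamma> n)) \<le> ?c"
      using z by simp
    then show False
      using elim(2) by linarith
  qed
  then show False
    by simp
qed

text \<open>Convergence in the subspace also requires the limit to lie in it: closedness puts it in
  the closure, and it is not embedded.\<close>

lemma limitin_rib_pos:
  "limitin (top_of_set horo_boundary) (\<lambda>n. rib_pos (\<gamma> n)) (busemann_pos \<gamma>) sequentially"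
proof -
  have "busemann_pos \<gamma> \<in> closure (range horo_embed)"
    using rib_pos_in_horo_boundary
    by (intro Lim_in_closed_set[OF closed_closure _ _ tendsto_rib_pos])
      (auto simp: horo_boundary_def)
  then show ?thesis
    using busemann_pos_not_in_range rib_pos_in_horo_boundary tendsto_rib_pos
    by (simp add: limitin_subtopology horo_boundary_def)
qed

end

section \<open>Transfer to negative functions by reflection\<close>

lemma max_pos_add_1: "max_pos A + 1 = - min_pos ((\<lambda>i. - 1 - i) ` A)"
\<comment> \<open>For the empty set both sides are -\<infinity>; moving \<open>+ 1\<close> inside
  the supremum is done for nonempty sets.\<close>
proof (cases "A = {}")
  case True
  then show ?thesis
    by (simp add: max_pos_def min_pos_def bot_ereal_def top_ereal_def)
next
  case False
  have "max_pos A + 1 = (SUP i\<in>A. ereal (of_int i) + 1)"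
    unfolding max_pos_def using False by (intro SUP_ereal_add_left[symmetric]) auto
  also have "\<dots> = (SUP i\<in>A. - ereal (of_int (- 1 - i)))"
    by (intro SUP_cong) (auto simp: one_ereal_def)
  also have "\<dots> = - min_pos ((\<lambda>i. - 1 - i) ` A)"
    by (simp only: min_pos_def ereal_SUP_uminus_eq image_image)
  finally show ?thesis .
qed

lemma max_uminus_ereal: "max (- a) (- b) = - min a (b :: ereal)"
  by (auto simp: max_def min_def)

text \<open>Negation turns maxima into minima and reverses their difference, as
  \<open>rib_pos\<close> expects; the spine part is even.\<close>

lemma rib_neg_eq_rib_pos_mirror: "rib_neg f g = rib_pos (mirror f) (mirror g)"
proof -
  have "Max {max_pos A + 1, ereal (of_int p), ereal (of_int q)} =
      - Min {min_pos ((\<lambda>i. - 1 - i) ` A), ereal (of_int (- p)), ereal (of_int (- q))}" for A p q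
    by (simp add: max_pos_add_1 flip: max_uminus_ereal)
  from this[of "sym_diff (lit_set f) (lit_set g)" "position g" "position f"]
    this[of "lit_set f" "position f" 0]
  have "rib_neg f g - spine (position f) g =
      rib_pos (mirror f) (mirror g) - spine (position (mirror f)) (mirror g)"
    unfolding rib_neg_def rib_pos_def lit_set_mirror sym_diff_mirror position_mirror
    by (simp add: zero_ereal_def)
  then show ?thesis
    by (simp add: spine_def abs_minus_commute)
qed

lemma busemann_neg_eq_busemann_pos_mirror:
  "busemann_neg \<gamma> g = busemann_pos (\<lambda>n. mirror (\<gamma> n)) (mirror g)"
proof -
  have lim: "limit_lit (\<lambda>n. mirror (\<gamma> n)) = (\<lambda>i. - 1 - i) ` limit_lit \<gamma>"
  proof -
    have "i |\<in>| lit (mirror h) \<longleftrightarrow> - 1 - i |\<in>| lit h" for i h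
      by (force simp: mirror_def)
    moreover have "{i. P (- 1 - i)} = (\<lambda>i::int. - 1 - i) ` {i. P i}" for P
      by (force simp: image_iff)
    ultimately show ?thesis
      by (simp add: limit_lit_def)
  qed
  have "max (max_pos A + 1) (ereal (of_int p)) =
      - min (min_pos ((\<lambda>i. - 1 - i) ` A)) (ereal (of_int (- p)))" for A p
    by (simp add: max_pos_add_1 flip: max_uminus_ereal)
  from this[of "sym_diff (limit_lit \<gamma>) (lit_set g)" "position g"] this[of "limit_lit \<gamma>" 0]
  show ?thesis
    unfolding busemann_neg_def busemann_pos_def lim lit_set_mirror sym_diff_mirror position_mirror
    by (simp add: zero_ereal_def)
qed

lemma horo_embed_mirror: "horo_embed z (mirror x) = horo_embed (mirror z) x"
  using d_mirror[of z "mirror x"] d_mirror[of z "\<one>\<^bsub>lamplighter\<^esub>"] by (simp add: horo_embed_def)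

text \<open>Composition with \<open>mirror\<close> is a continuous involution that maps embedded
  points to embedded points.\<close>

lemma mirror_in_horo_boundary:
  assumes "b \<in> horo_boundary"
  shows "(\<lambda>g. b (mirror g)) \<in> horo_boundary"
proof -
  let ?M = "\<lambda>(b :: lampstand \<Rightarrow> real) g. b (mirror g)"
  have M: "?M (horo_embed z) = horo_embed (mirror z)" for z
    by (simp add: horo_embed_mirror)
  have "continuous_on (closure (range horo_embed)) ?M"
    by (intro continuous_on_coordinatewise_then_product continuous_on_subset[OF continuous_on_product_coordinates]) simp
  then have "?M ` closure (range horo_embed) \<subseteq> closure (range horo_embed)"
    by (rule image_closure_subset) (auto simp: M intro: subsetD[OF closure_subset])
  moreover have "?M b \<notin> range horo_embed"
  proof
    assume "?M b \<in> range horo_embed"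
    then obtain z where "?M b = horo_embed z"
      by blast
    then have "?M (?M b) = ?M (horo_embed z)"
      by (rule arg_cong)
    then have "b = horo_embed (mirror z)"
      by (simp add: M)
    then show False
      using assms by (simp add: horo_boundary_def)
  qed
  ultimately show ?thesis
    using assms unfolding horo_boundary_def by blast
qed

lemma geodesic_ray_mirror: "geodesic_ray \<gamma> \<Longrightarrow> geodesic_ray (\<lambda>n. mirror (\<gamma> n))"
  by (simp add: geodesic_ray_def)

section \<open>Ray classes and the conclusion\<close>

lemma ray_class_eqD:
  assumes "ray_class \<gamma> = ray_class \<gamma>'" "geodesic_ray \<gamma>"
  shows "\<exists>C. \<forall>n. \<bar>position (\<gamma> n) - position (\<gamma>' n)\<bar> \<le> C"
proof -
  have "d (\<gamma> n) (\<gamma> n) = 0" for n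
    using assms(2) by (simp add: geodesic_ray_def)
  then have "\<gamma> \<in> ray_class \<gamma>"
    using assms(2) by (simp add: ray_class_def)
  then have "\<gamma> \<in> ray_class \<gamma>'"
    by (simp only: assms(1))
  then obtain C where C: "\<And>n. d (\<gamma>' n) (\<gamma> n) \<le> C"
    by (auto simp: ray_class_def bdd_above_def)
  have "\<bar>position (\<gamma> n) - position (\<gamma>' n)\<bar> \<le> \<lceil>C\<rceil>" for n
    using C[of n] abs_position_diff_le_d[of "\<gamma> n" "\<gamma>' n"] by linarith
  then show ?thesis
    by blast
qed

text \<open>The class only provides some representative with diverging position; a bounded distance
  bounds the position gap, so the given ray diverges too.\<close>

lemma position_at_top_if_visual_boundary_pos:
  assumes "ray_class \<gamma> \<in> visual_boundary_pos" "geodesic_ray \<gamma>"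
  shows "filterlim (\<lambda>n. position (\<gamma> n)) at_top sequentially"
proof -
  obtain \<gamma>' where \<gamma>': "ray_class \<gamma> = ray_class \<gamma>'"
    "filterlim (\<lambda>n. position (\<gamma>' n)) at_top sequentially"
    using assms(1) by (auto simp: visual_boundary_pos_def)
  obtain C where C: "\<And>n. \<bar>position (\<gamma> n) - position (\<gamma>' n)\<bar> \<le> C"
    using ray_class_eqD[OF \<gamma>'(1) assms(2)] by blast
  show ?thesis
    unfolding filterlim_at_top
  proof
    fix Z
    have "\<forall>\<^sub>F n in sequentially. Z + C \<le> position (\<gamma>' n)"
      using \<gamma>'(2) by (simp only: filterlim_at_top)
    then show "\<forall>\<^sub>F n in sequentially. Z \<le> position (\<gamma> n)"
    proof eventually_elim
      case (elim n)
      then show ?case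
        using C[of n] by arith
    qed
  qed
qed

lemma position_at_bot_if_visual_boundary_neg:
  assumes "ray_class \<gamma> \<in> visual_boundary_neg" "geodesic_ray \<gamma>"
  shows "filterlim (\<lambda>n. position (\<gamma> n)) at_bot sequentially"
proof -
  obtain \<gamma>' where \<gamma>': "ray_class \<gamma> = ray_class \<gamma>'"
    "filterlim (\<lambda>n. position (\<gamma>' n)) at_bot sequentially"
    using assms(1) by (auto simp: visual_boundary_neg_def)
  obtain C where C: "\<And>n. \<bar>position (\<gamma> n) - position (\<gamma>' n)\<bar> \<le> C"
    using ray_class_eqD[OF \<gamma>'(1) assms(2)] by blast
  show ?thesis
    unfolding filterlim_at_bot
  proof
    fix Z
    have "\<forall>\<^sub>F n in sequentially. position (\<gamma>' n) \<le> Z - C"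
      using \<gamma>'(2) by (simp only: filterlim_at_bot)
    then show "\<forall>\<^sub>F n in sequentially. position (\<gamma> n) \<le> Z"
    proof eventually_elim
      case (elim n)
      then show ?case
        using C[of n] by arith
    qed
  qed
qed

lemma max_pos_less:
  assumes "finite A" "\<And>i. i \<in> A \<Longrightarrow> i < c"
  shows "max_pos A < ereal (of_int c)"
  using assms by (induction A) (auto simp: max_pos_def bot_ereal_def sup_max)

theorem mainTheorem8:
  fixes \<gamma> :: "nat \<Rightarrow> lampstand"
  assumes "geodesic_ray \<gamma>" and "\<gamma> 0 = \<one>\<^bsub>lamplighter\<^esub>"
  shows "(ray_class \<gamma> \<in> visual_boundary_pos \<longrightarrow>
            (\<forall>\<^sub>F n in sequentially. max_pos (lit_set (\<gamma> n)) < pos_ereal (\<gamma> n)) \<and>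
            limitin (top_of_set horo_boundary) (\<lambda>n. rib_pos (\<gamma> n)) (busemann_pos \<gamma>) sequentially)
       \<and> (ray_class \<gamma> \<in> visual_boundary_neg \<longrightarrow>
            (\<forall>\<^sub>F n in sequentially. min_pos (lit_set (\<gamma> n)) \<ge> pos_ereal (\<gamma> n)) \<and>
            limitin (top_of_set horo_boundary) (\<lambda>n. rib_neg (\<gamma> n)) (busemann_neg \<gamma>) sequentially)"
proof (intro conjI[of "_ \<longrightarrow> _" "_ \<longrightarrow> _"] impI)
  assume "ray_class \<gamma> \<in> visual_boundary_pos"
  then interpret upward_ray \<gamma>
    using assms by unfold_locales (auto intro: position_at_top_if_visual_boundary_pos)
  have "\<forall>\<^sub>F n in sequentially. max_pos (lit_set (\<gamma> n)) < pos_ereal (\<gamma> n)"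
    using eventually_lit_less_position by eventually_elim (auto intro: max_pos_less)
  then show "(\<forall>\<^sub>F n in sequentially. max_pos (lit_set (\<gamma> n)) < pos_ereal (\<gamma> n)) \<and>
      limitin (top_of_set horo_boundary) (\<lambda>n. rib_pos (\<gamma> n)) (busemann_pos \<gamma>) sequentially"
    using limitin_rib_pos by blast
next
  assume neg: "ray_class \<gamma> \<in> visual_boundary_neg"
  interpret upward_ray "\<lambda>n. mirror (\<gamma> n)"
  proof
    show "filterlim (\<lambda>n. position (mirror (\<gamma> n))) at_top sequentially"
      unfolding filterlim_at_top
    proof
      fix Z
      have "\<forall>\<^sub>F n in sequentially. position (\<gamma> n) \<le> - Z"
        using position_at_bot_if_visual_boundary_neg[OF neg assms(1)] by (simp only: filterlim_at_bot)
      then show "\<forall>\<^sub>F n in sequentially. Z \<le> position (mirror (\<gamma> n))"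
        by eventually_elim simp
    qed
  qed (use assms geodesic_ray_mirror in auto)
  have "\<forall>\<^sub>F n in sequentially. pos_ereal (\<gamma> n) \<le> min_pos (lit_set (\<gamma> n))"
    using eventually_lit_less_position
  \<comment> \<open>A lamp \<open>i\<close> reflects to \<open>- 1 - i\<close>, and
    \<open>- 1 - i < - position (\<gamma> n)\<close> means
    \<open>position (\<gamma> n) \<le> i\<close>: the strict bound becomes a weak one.\<close>
  proof eventually_elim
    case (elim n)
    then show ?case
      by (force simp: min_pos_def intro: INF_greatest)
  qed
  moreover have "limitin (top_of_set horo_boundary) (\<lambda>n. rib_neg (\<gamma> n)) (busemann_neg \<gamma>) sequentially"
    using limitin_rib_pos mirror_in_horo_boundary
    by (auto simp: limitin_subtopology tendsto_fun_iff rib_neg_eq_rib_pos_mirror[abs_def]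
        busemann_neg_eq_busemann_pos_mirror[abs_def] elim: eventually_mono)
  ultimately show "(\<forall>\<^sub>F n in sequentially. pos_ereal (\<gamma> n) \<le> min_pos (lit_set (\<gamma> n))) \<and>
      limitin (top_of_set horo_boundary) (\<lambda>n. rib_neg (\<gamma> n)) (busemann_neg \<gamma>) sequentially"
    by blast
qed

end
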